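(* Let $D_1, D_2$ be finite sets, let $P \subsetneq Q \subseteq D_1^{r_1}$ and $R \subsetneq S \subseteq D_2^{r_2}$ be predicates, and let $\mathcal I = (I_1, \dots, I_{r_2})$ be a sequence of subsets of $[r_1]$ such that $P \mid Q$ is an $\mathcal I$-substructure of $R \mid S$. Suppose $H_1 = (V_1, E_1), H_2 = (V_2, E_2), \dots$ is an infinite sequence of $r_1$-partite non-redundant instances of $\operatorname{CSP}(P \mid Q)$, and suppose there are constants $C_1, C_2 > 0$ and $0 < \varepsilon < 1$ such that for all $i \ge 1$: (1) for every $j \in [r_2]$, $|\pi_{I_j} E_i| \le C_1 |E_i|^{1-\varepsilon}$ (i.e. $H_i$ is $(|E_i|^{\varepsilon}/C_1, \mathcal I)$-shrinking), and (2) $1 \le |E_{i+1}|/|E_i| \le C_2$. Then $\operatorname{NRD}(R \mid S, n) = \Omega\big(n^{\frac{1}{1-\varepsilon}}\big)$, where the $\Omega$ hides constant factors depending on $|E_1|, C_1, C_2, r_1, r_2, \varepsilon$.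
   Context: An $r$-uniform hypergraph (instance) is a pair $H=(V,E)$ with $E \subseteq V^r$ (edges are ordered tuples). An assignment is a map $\psi: V \to D$, and $\psi(e) := (\psi(e_1),\dots,\psi(e_r))$. For predicates $P \subsetneq Q \subseteq D^r$, $H$ is a (conditionally) non-redundant instance of $\operatorname{CSP}(P \mid Q)$ if for every $e \in E$ there is an assignment $\psi_e$ with $\psi_e(e') \in P$ for all $e' \in E\setminus\{e\}$ and $\psi_e(e) \in Q \setminus P$. $\operatorname{NRD}(P \mid Q, n)$ is the maximum number of edges of a non-redundant instance of $\operatorname{CSP}(P\mid Q)$ on $n$ vertices. $H$ is $r$-partite if $V = V_1 \sqcup \dots \sqcup V_r$ with $E \subseteq V_1 \times \dots \times V_r$. For $I \subseteq [r]$ and an $r$-tuple $x$, $\pi_I x = (x_i : i \in I)$; for a set $E$ of tuples, $\pi_I E = \{\pi_I e : e \in E\}$. For $P \subsetneq Q \subseteq D_1^{r_1}$, $R \subsetneq S \subseteq D_2^{r_2}$ and a sequence $\mathcal I = (I_1,\dots,I_{r_2})$ of subsets of $[r_1]$, $P\mid Q$ is an $\mathcal I$-substructure of $R \mid S$ if there exist maps $g_j : D_1^{I_j} \to D_2$ ($j \in [r_2]$) such that $(g_1(\pi_{I_1}x),\dots,g_{r_2}(\pi_{I_{r_2}}x)) \in R$ for all $x \in P$ and $\in S\setminus R$ for all $x \in Q \setminus P$. An $r$-partite hypergraph is $(\lambda,\mathcal I)$-shrinking if $|\pi_I E| \le |E|/\lambda$ for all $I \in \mathcal I$.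
   Formalization: The formal theorem additionally assumes that |E_i| tends to infinity; without this the claim fails, e.g. for a constant sequence of one-vertex, one-edge unary instances with P=R={0}, Q=S={0,1}, ε=1/2, where NRD(R|S,n)=n. *)

theory Defs
  imports Complex_Main "HOL-Library.FuncSet" "HOL-Library.Disjoint_Sets"
begin

(* An r-tuple is an extensional function on the index set [r] = {1..r}, so that the
   projection to a set of coordinates is restriction and D^I is "I \<rightarrow>\<^sub>E D". *)

definition tuples :: "nat \<Rightarrow> 'a set \<Rightarrow> (nat \<Rightarrow> 'a) set" where
  "tuples r D = {1..r} \<rightarrow>\<^sub>E D"

definition proj :: "nat set \<Rightarrow> (nat \<Rightarrow> 'a) \<Rightarrow> (nat \<Rightarrow> 'a)" where
  "proj I x = restrict x I"

definition assign :: "nat \<Rightarrow> ('v \<Rightarrow> 'a) \<Rightarrow> (nat \<Rightarrow> 'v) \<Rightarrow> (nat \<Rightarrow> 'a)" where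
  "assign r \<psi> e = (\<lambda>k\<in>{1..r}. \<psi> (e k))"

definition r_uniform :: "nat \<Rightarrow> 'v set \<Rightarrow> (nat \<Rightarrow> 'v) set \<Rightarrow> bool" where
  "r_uniform r V E \<longleftrightarrow> E \<subseteq> tuples r V"

definition non_redundant ::
  "nat \<Rightarrow> 'a set \<Rightarrow> (nat \<Rightarrow> 'a) set \<Rightarrow> (nat \<Rightarrow> 'a) set \<Rightarrow> 'v set \<Rightarrow> (nat \<Rightarrow> 'v) set \<Rightarrow> bool" where
  "non_redundant r D P Q V E \<longleftrightarrow>
     r_uniform r V E \<and>
     (\<forall>e\<in>E. \<exists>\<psi>\<in>V \<rightarrow> D.
        (\<forall>e'\<in>E - {e}. assign r \<psi> e' \<in> P) \<and> assign r \<psi> e \<in> Q - P)"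

(* Vertices are taken from nat, which loses nothing as only the number n of vertices matters.
   The maximum is over a finite set (at most n^r edges) containing 0 (the edgeless instance). *)

definition NRD :: "nat \<Rightarrow> 'a set \<Rightarrow> (nat \<Rightarrow> 'a) set \<Rightarrow> (nat \<Rightarrow> 'a) set \<Rightarrow> nat \<Rightarrow> nat" where
  "NRD r D P Q n =
     Max {card E | (V :: nat set) E. finite V \<and> card V = n \<and> non_redundant r D P Q V E}"

definition r_partite :: "nat \<Rightarrow> 'v set \<Rightarrow> (nat \<Rightarrow> 'v) set \<Rightarrow> bool" where
  "r_partite r V E \<longleftrightarrow>
     (\<exists>W :: nat \<Rightarrow> 'v set. disjoint_family_on W {1..r} \<and> V = (\<Union>k\<in>{1..r}. W k) \<and>
        E \<subseteq> (\<Pi>\<^sub>E k\<in>{1..r}. W k))"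

definition substructure ::
  "'a set \<Rightarrow> (nat \<Rightarrow> 'a) set \<Rightarrow> (nat \<Rightarrow> 'a) set \<Rightarrow>
   nat \<Rightarrow> 'b set \<Rightarrow> (nat \<Rightarrow> 'b) set \<Rightarrow> (nat \<Rightarrow> 'b) set \<Rightarrow> (nat \<Rightarrow> nat set) \<Rightarrow> bool" where
  "substructure D\<^sub>1 P Q r\<^sub>2 D\<^sub>2 R S I \<longleftrightarrow>
     (\<exists>g :: nat \<Rightarrow> (nat \<Rightarrow> 'a) \<Rightarrow> 'b.
        (\<forall>j\<in>{1..r\<^sub>2}. g j \<in> (I j \<rightarrow>\<^sub>E D\<^sub>1) \<rightarrow> D\<^sub>2) \<and>
        (\<forall>x\<in>P. (\<lambda>j\<in>{1..r\<^sub>2}. g j (proj (I j) x)) \<in> R) \<and>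
        (\<forall>x\<in>Q - P. (\<lambda>j\<in>{1..r\<^sub>2}. g j (proj (I j) x)) \<in> S - R))"

end

(* Replace each edge e by the tuple of its projections, the j-th vertex class being
   proj (I j) ` E. Since g j only looks at the coordinates in I j, the witness for e of the old
   instance induces one of the new instance, so all |E| edges survive on at most
   r\<^sub>2 C\<^sub>1 |E|^(1 - \<epsilon>) vertices. As |E i| grows by at most a factor C\<^sub>2 per step, for every
   large n some E i is within a constant factor of the largest size that fits on n vertices. *)

theory Submission imports Defs "HOL-Real_Asymp.Real_Asymp" begin

section \<open>Tuples, assignments and witnesses\<close>

lemma finite_tuples: "finite V \<Longrightarrow> finite (tuples r V)"
  unfolding tuples_def by (simp add: finite_PiE)

lemma card_tuples: "card (tuples r V) = card V ^ r"
  unfolding tuples_def by (simp add: card_PiE)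

lemma assign_cong:
  assumes "\<And>k. k \<in> {1..r} \<Longrightarrow> \<psi> (e k) = \<psi>' (e' k)"
  shows "assign r \<psi> e = assign r \<psi>' e'"
  unfolding assign_def using assms by (intro restrict_ext) auto

lemma non_redundant_vertex:
  assumes "non_redundant r D P Q V E" "e \<in> E" "k \<in> {1..r}"
  shows "e k \<in> V"
proof -
  have "e \<in> {1..r} \<rightarrow>\<^sub>E V"
    using assms(1,2) unfolding non_redundant_def r_uniform_def tuples_def by blast
  then show ?thesis using assms(3) by (rule PiE_mem)
qed

lemma non_redundant_witness:
  assumes "non_redundant r D P Q V E" "e \<in> E"
  obtains \<psi> where "\<psi> \<in> V \<rightarrow> D" "\<forall>e'\<in>E - {e}. assign r \<psi> e' \<in> P" "assign r \<psi> e \<in> Q - P"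
  using assms unfolding non_redundant_def by blast

section \<open>Lower bounds on \<open>NRD\<close> from explicit instances\<close>

lemma card_le_NRD:
  fixes V :: "nat set"
  assumes "finite V" and "non_redundant r D P Q V E"
  shows "card E \<le> NRD r D P Q (card V)"
  unfolding NRD_def
proof (rule Max_ge)
  \<comment> \<open>\<open>Max\<close> bounds its elements only for a finite set. The edges are
    tuples over \<open>W\<close>, so every size that occurs is at most
    \<open>card V ^ r\<close>.\<close>
  show "finite {card E | (W :: nat set) E. finite W \<and> card W = card V \<and> non_redundant r D P Q W E}"
  proof (rule finite_subset)
    show "{card E | (W :: nat set) E. finite W \<and> card W = card V \<and> non_redundant r D P Q W E}
        \<subseteq> {..card V ^ r}"
    proof clarsimp
      fix W :: "nat set" and E
      assume W: "finite W" "card W = card V" and "non_redundant r D P Q W E"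
      then have "E \<subseteq> tuples r W"
        by (auto simp: non_redundant_def r_uniform_def)
      then have "card E \<le> card (tuples r W)"
        using W by (intro card_mono finite_tuples)
      then show "card E \<le> card V ^ r"
        using W by (simp add: card_tuples)
    qed
  qed simp
  show "card E \<in> {card E | (W :: nat set) E.
      finite W \<and> card W = card V \<and> non_redundant r D P Q W E}"
    using assms by blast
qed

text \<open>Injectivity comes for free: the witness for \<open>e\<close> sends \<open>F e\<close>
  outside \<open>P\<close> and every other \<open>F e'\<close> into \<open>P\<close>, so two edges
  cannot share an image. Hence witnesses indexed by \<open>E\<close> also serve the image
  edges.\<close>

lemma non_redundant_image:
  assumes F: "\<And>e. e \<in> E \<Longrightarrow> F e \<in> tuples r V"
    and \<psi>: "\<And>e. e \<in> E \<Longrightarrow> \<exists>\<psi>\<in>V \<rightarrow> D. (\<forall>e'\<in>E - {e}. assign r \<psi> (F e') \<in> P) \<and> assign r \<psi> (F e) \<in> Q - P"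
  shows "inj_on F E" and "non_redundant r D P Q V (F ` E)"
proof -
  show "inj_on F E"
  proof (rule inj_onI, rule ccontr)
    fix e e' assume "e \<in> E" "e' \<in> E" "F e = F e'" "e \<noteq> e'"
    then show False using \<psi>[of e] by force
  qed
  show "non_redundant r D P Q V (F ` E)"
    unfolding non_redundant_def r_uniform_def using F \<psi> by (fastforce simp: image_iff)
qed

text \<open>An injection into \<open>{..<n}\<close> renames the vertices to natural numbers, as
  \<open>NRD\<close> demands, and pads them with isolated ones up to exactly
  \<open>n\<close>.\<close>

lemma card_le_NRD_of_card_le:
  fixes E :: "(nat \<Rightarrow> 'v) set"
  assumes nr: "non_redundant r D P Q V E" and V: "finite V" "card V \<le> n" and D: "D \<noteq> {}"
  shows "card E \<le> NRD r D P Q n"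
proof -
  obtain h where h: "inj_on h V" "h ` V \<subseteq> {..<n}"
    using card_le_inj[of V "{..<n}"] V by auto
  obtain d where d: "d \<in> D" using D by auto
  define F where "F e = (\<lambda>k\<in>{1..r}. h (e k))" for e :: "nat \<Rightarrow> 'v"
  have E: "e k \<in> V" if "e \<in> E" "k \<in> {1..r}" for e k
    using non_redundant_vertex[OF nr that] .
  have F_in: "F e \<in> tuples r {..<n}" if "e \<in> E" for e
    unfolding F_def tuples_def restrict_PiE_iff using E[OF that] h(2) by blast
  have witness: "\<exists>\<psi>\<in>{..<n} \<rightarrow> D. (\<forall>e'\<in>E - {e}. assign r \<psi> (F e') \<in> P) \<and> assign r \<psi> (F e) \<in> Q - P"
    if e: "e \<in> E" for e
  proof -
    obtain \<psi> where \<psi>: "\<psi> \<in> V \<rightarrow> D" "\<forall>e'\<in>E - {e}. assign r \<psi> e' \<in> P" "assign r \<psi> e \<in> Q - P"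
      using non_redundant_witness[OF nr e] .
    \<comment> \<open>The added vertices lie on no edge, so any value \<open>d\<close> in
      \<open>D\<close> will do for them.\<close>
    define \<psi>' where "\<psi>' x = (if x \<in> h ` V then \<psi> (inv_into V h x) else d)" for x
    have "assign r \<psi>' (F e') = assign r \<psi> e'" if "e' \<in> E" for e'
      using E[OF that] h(1) by (intro assign_cong) (auto simp: F_def \<psi>'_def)
    moreover have "\<psi>' \<in> {..<n} \<rightarrow> D"
      using \<psi>(1) d h(1) by (force simp: \<psi>'_def)
    ultimately show ?thesis using \<psi> that by (intro bexI[of _ \<psi>']) auto
  qed
  have "card (F ` E) \<le> NRD r D P Q (card {..<n})"
    by (intro card_le_NRD non_redundant_image(2)) (use F_in witness in auto)
  then show ?thesis
    using card_image[OF non_redundant_image(1)[OF F_in witness]] by simp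
qed

section \<open>From an instance of the substructure to an instance of \<open>R\<close> and
  \<open>S\<close>\<close>

lemma non_redundant_substructure:
  fixes E :: "(nat \<Rightarrow> 'v) set"
  assumes nr: "non_redundant r\<^sub>1 D\<^sub>1 P Q V E"
    and sub: "substructure D\<^sub>1 P Q r\<^sub>2 D\<^sub>2 R S I"
    and I: "\<And>j. j \<in> {1..r\<^sub>2} \<Longrightarrow> I j \<subseteq> {1..r\<^sub>1}"
  obtains E' where "card E' = card E"
    and "non_redundant r\<^sub>2 D\<^sub>2 R S (SIGMA j:{1..r\<^sub>2}. proj (I j) ` E) E'"
proof -
  let ?U = "SIGMA j:{1..r\<^sub>2}. proj (I j) ` E"
  obtain g where g: "\<forall>j\<in>{1..r\<^sub>2}. g j \<in> (I j \<rightarrow>\<^sub>E D\<^sub>1) \<rightarrow> D\<^sub>2"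
    "\<forall>x\<in>P. (\<lambda>j\<in>{1..r\<^sub>2}. g j (proj (I j) x)) \<in> R"
    "\<forall>x\<in>Q - P. (\<lambda>j\<in>{1..r\<^sub>2}. g j (proj (I j) x)) \<in> S - R"
    using sub unfolding substructure_def by (elim exE conjE)
  \<comment> \<open>The tag \<open>j\<close> keeps the vertex classes disjoint even if some
    \<open>I j\<close> coincide, and it tells an assignment which \<open>g j\<close> to
    apply.\<close>
  define F where "F e = (\<lambda>j\<in>{1..r\<^sub>2}. (j, proj (I j) e))" for e :: "nat \<Rightarrow> 'v"
  have F_in: "F e \<in> tuples r\<^sub>2 ?U" if "e \<in> E" for e
    using that by (auto simp: F_def tuples_def)
  have witness: "\<exists>\<psi>\<in>?U \<rightarrow> D\<^sub>2. (\<forall>e'\<in>E - {e}. assign r\<^sub>2 \<psi> (F e') \<in> R) \<and> assign r\<^sub>2 \<psi> (F e) \<in> S - R"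
    if e: "e \<in> E" for e
  proof -
    obtain \<psi> where \<psi>: "\<psi> \<in> V \<rightarrow> D\<^sub>1" "\<forall>e'\<in>E - {e}. assign r\<^sub>1 \<psi> e' \<in> P" "assign r\<^sub>1 \<psi> e \<in> Q - P"
      using non_redundant_witness[OF nr e] .
    define \<psi>' where "\<psi>' = (\<lambda>(j, y). g j (\<lambda>k\<in>I j. \<psi> (y k)))"
    have "assign r\<^sub>2 \<psi>' (F e') = (\<lambda>j\<in>{1..r\<^sub>2}. g j (proj (I j) (assign r\<^sub>1 \<psi> e')))" for e'
      unfolding assign_def[of r\<^sub>2]
    proof (rule restrict_ext)
      fix j assume j: "j \<in> {1..r\<^sub>2}"
      \<comment> \<open>This relies on \<open>I j\<close> lying inside
        \<open>{1..r\<^sub>1}\<close>: outside that range \<open>assign\<close> yields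
        \<open>undefined\<close> instead of a value of \<psi>.\<close>
      have "(\<lambda>k\<in>I j. \<psi> (proj (I j) e' k)) = proj (I j) (assign r\<^sub>1 \<psi> e')"
        using I[OF j] by (auto simp: proj_def assign_def fun_eq_iff restrict_def)
      then show "\<psi>' (F e' j) = g j (proj (I j) (assign r\<^sub>1 \<psi> e'))"
        using j by (simp add: F_def \<psi>'_def)
    qed
    moreover have "\<psi>' \<in> ?U \<rightarrow> D\<^sub>2"
    proof clarify
      fix j e' assume j: "j \<in> {1..r\<^sub>2}" and "e' \<in> E"
      then have "e' k \<in> V" if "k \<in> I j" for k
        using non_redundant_vertex[OF nr] I[OF j] that by blast
      then have "(\<lambda>k\<in>I j. \<psi> (proj (I j) e' k)) \<in> I j \<rightarrow>\<^sub>E D\<^sub>1"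
        using \<psi>(1) by (auto simp: proj_def)
      with g(1) j show "\<psi>' (j, proj (I j) e') \<in> D\<^sub>2"
        unfolding \<psi>'_def case_prod_conv by blast
    qed
    ultimately show ?thesis
      using g(2,3) \<psi> by (intro bexI[of _ \<psi>']) simp_all
  qed
  show ?thesis
    using that card_image[OF non_redundant_image(1)[OF F_in witness]]
      non_redundant_image(2)[OF F_in witness] by blast
qed

text \<open>The tagged vertex classes are disjoint, so their sizes add up; finiteness of
  \<open>E\<close> makes each of them finite.\<close>

lemma card_le_NRD_substructure:
  fixes E :: "(nat \<Rightarrow> 'v) set"
  assumes nr: "non_redundant r\<^sub>1 D\<^sub>1 P Q V E"
    and sub: "substructure D\<^sub>1 P Q r\<^sub>2 D\<^sub>2 R S I"
    and I: "\<And>j. j \<in> {1..r\<^sub>2} \<Longrightarrow> I j \<subseteq> {1..r\<^sub>1}"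
    and E: "finite E" and D: "D\<^sub>2 \<noteq> {}"
    and n: "(\<Sum>j\<in>{1..r\<^sub>2}. card (proj (I j) ` E)) \<le> n"
  shows "card E \<le> NRD r\<^sub>2 D\<^sub>2 R S n"
proof -
  obtain E' where E': "card E' = card E"
    "non_redundant r\<^sub>2 D\<^sub>2 R S (SIGMA j:{1..r\<^sub>2}. proj (I j) ` E) E'"
    using non_redundant_substructure[OF nr sub I] by blast
  have "card E' \<le> NRD r\<^sub>2 D\<^sub>2 R S n"
    by (rule card_le_NRD_of_card_le[OF E'(2) _ _ D]) (use E n in auto)
  then show ?thesis using E'(1) by simp
qed

text \<open>There is only one tuple of length 0, and passing to projections preserves the number of
  edges. This rules out \<open>r\<^sub>2 = 0\<close> for instances of unbounded size.\<close>

lemma substructure_arity_zero: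
  fixes E :: "(nat \<Rightarrow> 'v) set"
  assumes nr: "non_redundant r\<^sub>1 D\<^sub>1 P Q V E"
    and sub: "substructure D\<^sub>1 P Q 0 D\<^sub>2 R S I"
  shows "card E \<le> 1"
proof -
  obtain E' where E': "card E' = card E" "non_redundant 0 D\<^sub>2 R S (SIGMA j:{1..0}. proj (I j) ` E) E'"
    using non_redundant_substructure[OF nr sub] by auto
  then have "E' \<subseteq> {\<lambda>_. undefined}"
    by (auto simp: non_redundant_def r_uniform_def tuples_def)
  then have "card E' \<le> card {\<lambda>_ :: nat. undefined :: nat \<times> (nat \<Rightarrow> 'v)}"
    by (intro card_mono) auto
  then show ?thesis using E' by simp
qed

section \<open>Choosing an instance that fits on \<open>n\<close> vertices\<close>

lemma ex_last_below:
  fixes a :: "nat \<Rightarrow> real"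
  assumes "a 1 \<le> b" and "filterlim a at_top sequentially"
  obtains i where "i \<ge> 1" "a i \<le> b" "b < a (i + 1)"
proof -
  have "eventually (\<lambda>i. b < a i \<and> 1 \<le> i) sequentially"
    using filterlim_at_top_dense[THEN iffD1, OF assms(2)] eventually_ge_at_top
    by (intro eventually_conj) auto
  then obtain k where k: "1 \<le> k" "b < a k"
    by (metis (mono_tags, lifting) eventually_sequentially le_refl)
  \<comment> \<open>As \<open>a\<close> may fail to be monotone, take the first index beyond 0 at
    which \<open>b\<close> is exceeded and step back by one. The \<open>Suc\<close> skips
    \<open>a 0\<close>, about which nothing is known; \<open>a 1 \<le> b\<close> leaves room for the
    step back.\<close>
  define j where "j = (LEAST j. b < a (Suc j))"
  obtain l where "k = Suc l" using k(1) by (cases k) auto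
  then have j: "b < a (Suc j)" unfolding j_def using k(2) by (metis LeastI)
  then have "j \<noteq> 0" using assms(1) by (cases j) auto
  then obtain j' where j': "j = Suc j'" by (cases j) auto
  then have "\<not> b < a (Suc j')" unfolding j_def by (metis not_less_Least lessI)
  then show ?thesis using that[of j] j j' by simp
qed

theorem theorem3p5:
  fixes r\<^sub>1 r\<^sub>2 m :: nat and C\<^sub>1 C\<^sub>2 \<epsilon> :: real
  assumes "C\<^sub>1 > 0" "C\<^sub>2 > 0" "0 < \<epsilon>" "\<epsilon> < 1"
  shows "\<exists>c>0. \<exists>n\<^sub>0 :: nat.
    \<forall>(D\<^sub>1 :: 'a set) (D\<^sub>2 :: 'b set) P Q R S (I :: nat \<Rightarrow> nat set)
      (V :: nat \<Rightarrow> 'v set) (E :: nat \<Rightarrow> (nat \<Rightarrow> 'v) set).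
      finite D\<^sub>1 \<longrightarrow> finite D\<^sub>2 \<longrightarrow>
      P \<subset> Q \<longrightarrow> Q \<subseteq> tuples r\<^sub>1 D\<^sub>1 \<longrightarrow>
      R \<subset> S \<longrightarrow> S \<subseteq> tuples r\<^sub>2 D\<^sub>2 \<longrightarrow>
      (\<forall>j\<in>{1..r\<^sub>2}. I j \<subseteq> {1..r\<^sub>1}) \<longrightarrow>
      substructure D\<^sub>1 P Q r\<^sub>2 D\<^sub>2 R S I \<longrightarrow>
      (\<forall>i\<ge>1. r_partite r\<^sub>1 (V i) (E i) \<and> non_redundant r\<^sub>1 D\<^sub>1 P Q (V i) (E i)) \<longrightarrow>
      card (E 1) = m \<longrightarrow>
      filterlim (\<lambda>i. card (E i)) at_top sequentially \<longrightarrow>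
      (\<forall>i\<ge>1. \<forall>j\<in>{1..r\<^sub>2}.
         real (card (proj (I j) ` E i)) \<le> C\<^sub>1 * real (card (E i)) powr (1 - \<epsilon>)) \<longrightarrow>
      (\<forall>i\<ge>1. 1 \<le> real (card (E (i + 1))) / real (card (E i)) \<and>
         real (card (E (i + 1))) / real (card (E i)) \<le> C\<^sub>2) \<longrightarrow>
      (\<forall>n\<ge>n\<^sub>0. c * real n powr (1 / (1 - \<epsilon>)) \<le> real (NRD r\<^sub>2 D\<^sub>2 R S n))"
proof -
  \<comment> \<open>The new instance built from \<open>E i\<close> has at most \<open>K\<close>
    times the \<delta>-th power of \<open>card (E i)\<close> vertices. The \<open>max\<close> keeps
    \<open>K\<close> positive before \<open>r\<^sub>2 = 0\<close> is excluded. Solving for the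
    number of edges gives the power of \<open>1 / K\<close> in \<open>c\<close>, one step of the
    sequence costs the factor \<open>C\<^sub>2\<close>, and \<open>n\<^sub>0\<close> ensures that
    the first instance fits.\<close>
  define K where "K = real (max r\<^sub>2 1) * C\<^sub>1"
  define \<delta> where "\<delta> = 1 - \<epsilon>"
  define c where "c = (1 / K) powr (1 / \<delta>) / C\<^sub>2"
  define n\<^sub>0 where "n\<^sub>0 = nat \<lceil>K * real m powr \<delta>\<rceil>"
  have K: "K > 0" unfolding K_def using assms(1) by simp
  have \<delta>: "\<delta> > 0" unfolding \<delta>_def using assms(4) by simp
  show ?thesis
    unfolding \<delta>_def[symmetric]
  proof (intro exI[of _ c] exI[of _ n\<^sub>0] conjI allI impI)
    show "c > 0" unfolding c_def using K assms(2) by simp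
  next
    fix D\<^sub>1 :: "'a set" and D\<^sub>2 :: "'b set" and P Q R S and I :: "nat \<Rightarrow> nat set"
      and V :: "nat \<Rightarrow> 'v set" and E :: "nat \<Rightarrow> (nat \<Rightarrow> 'v) set" and n
    assume RS: "R \<subset> S" "S \<subseteq> tuples r\<^sub>2 D\<^sub>2"
      and I: "\<forall>j\<in>{1..r\<^sub>2}. I j \<subseteq> {1..r\<^sub>1}"
      and sub: "substructure D\<^sub>1 P Q r\<^sub>2 D\<^sub>2 R S I"
      and nr: "\<forall>i\<ge>1. r_partite r\<^sub>1 (V i) (E i) \<and> non_redundant r\<^sub>1 D\<^sub>1 P Q (V i) (E i)"
      and m: "card (E 1) = m"
      and lim: "filterlim (\<lambda>i. card (E i)) at_top sequentially"
      and shrink: "\<forall>i\<ge>1. \<forall>j\<in>{1..r\<^sub>2}.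
        real (card (proj (I j) ` E i)) \<le> C\<^sub>1 * real (card (E i)) powr \<delta>"
      and ratio: "\<forall>i\<ge>1. 1 \<le> real (card (E (i + 1))) / real (card (E i)) \<and>
        real (card (E (i + 1))) / real (card (E i)) \<le> C\<^sub>2"
      and n: "n\<^sub>0 \<le> n"
    have r2: "r\<^sub>2 \<noteq> 0"
    proof
      assume "r\<^sub>2 = 0"
      then have "card (E i) \<le> 1" if "i \<ge> 1" for i
        using substructure_arity_zero nr sub that by metis
      moreover have "eventually (\<lambda>i. 2 \<le> card (E i) \<and> 1 \<le> i) sequentially"
        using lim by (intro eventually_conj eventually_ge_at_top) (simp add: filterlim_at_top)
      then obtain i where "2 \<le> card (E i)" "1 \<le> i"
        by (metis (mono_tags, lifting) eventually_sequentially le_refl)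
      ultimately show False by fastforce
    qed
    \<comment> \<open>A nonempty \<open>S\<close> of positive arity forces a nonempty domain, which
      supplies the padding value.\<close>
    then have "tuples r\<^sub>2 {} = {}"
      by (auto simp: tuples_def PiE_eq_empty_iff)
    then have D2: "D\<^sub>2 \<noteq> {}"
      using RS by blast
    have "filterlim (\<lambda>n. K * real n powr \<delta>) at_top sequentially"
      using K \<delta> by real_asymp
    then have "filterlim (\<lambda>i. K * real (card (E i)) powr \<delta>) at_top sequentially"
      using lim by (rule filterlim_compose)
    moreover have "K * real (card (E 1)) powr \<delta> \<le> real n"
      using n unfolding m n\<^sub>0_def by linarith
    ultimately obtain i where i: "i \<ge> 1" "K * real (card (E i)) powr \<delta> \<le> real n"
      "real n < K * real (card (E (i + 1))) powr \<delta>"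
      using ex_last_below[of "\<lambda>i. K * real (card (E i)) powr \<delta>"] by metis
    \<comment> \<open>Division by zero gives 0, which violates the lower bound 1 on the ratio. Since
      infinite sets have cardinality 0, this also shows that \<open>E i\<close> is finite.\<close>
    have E_ne: "card (E i) \<noteq> 0"
    proof
      assume "card (E i) = 0"
      then show False using ratio[rule_format, OF i(1)] by simp
    qed
    have "real (\<Sum>j\<in>{1..r\<^sub>2}. card (proj (I j) ` E i)) \<le> (\<Sum>j\<in>{1..r\<^sub>2}. C\<^sub>1 * real (card (E i)) powr \<delta>)"
      unfolding of_nat_sum using shrink i(1) by (intro sum_mono) auto
    also have "\<dots> = K * real (card (E i)) powr \<delta>"
      using r2 by (simp add: K_def max_def)
    also have "\<dots> \<le> real n" by (rule i(2))
    finally have "(\<Sum>j\<in>{1..r\<^sub>2}. card (proj (I j) ` E i)) \<le> n"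
      unfolding of_nat_le_iff .
    then have NRD: "card (E i) \<le> NRD r\<^sub>2 D\<^sub>2 R S n"
      using nr i(1) I D2 E_ne sub
      by (intro card_le_NRD_substructure[of r\<^sub>1 D\<^sub>1 P Q "V i"]) (auto intro: card_ge_0_finite)
    \<comment> \<open>The next instance exceeds the vertex budget, so its number of edges is at
      least \<open>(n / K) powr (1 / \<delta>)\<close>; the ratio bound carries this back to
      \<open>E i\<close>.\<close>
    have "(real n / K) powr (1 / \<delta>) \<le> (real (card (E (i + 1))) powr \<delta>) powr (1 / \<delta>)"
      using i(3) K \<delta> by (intro powr_mono2) (auto simp: field_simps)
    also have "\<dots> = real (card (E (i + 1)))"
      using \<delta> by (simp add: powr_powr)
    also have "\<dots> \<le> C\<^sub>2 * real (card (E i))"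
      using ratio[rule_format, OF i(1)] E_ne by (simp add: pos_divide_le_eq)
    finally have "(1 / K) powr (1 / \<delta>) * real n powr (1 / \<delta>) \<le> C\<^sub>2 * real (card (E i))"
      using K by (simp add: powr_divide)
    then have "c * real n powr (1 / \<delta>) \<le> real (card (E i))"
      using assms(2) by (simp add: c_def field_simps)
    then show "c * real n powr (1 / \<delta>) \<le> real (NRD r\<^sub>2 D\<^sub>2 R S n)"
      using NRD by linarith
  qed
qed

end
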